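(* Let $V,Q$ be real separable Hilbert spaces, $V_h\subset V$ and $Q_h\subset Q$ closed subspaces, $X_h=V_h\times Q_h$, $L\in L(V,V')$, $B\in L(V,Q')$, $T\in L(Q_h,Q_h')$. Let $A_h\in L(X_h,X_h')$ be defined by $$\langle A_h(u,p),(v,q)\rangle_{X_h',X_h}=\langle Lu-B^*p,v\rangle_{V',V}+\langle Bu,q\rangle_{Q',Q}+\langle Tp,q\rangle_{Q_h',Q_h}$$ for $(u,p),(v,q)\in X_h$. Assume (A1) there is $\alpha>0$ with $\langle Lu,u\rangle_{V',V}\ge\alpha\|u\|_V^2$ for all $u\in V$; (A2a) $\langle Tp,p\rangle_{Q_h',Q_h}\ge0$ for all $p\in Q_h$; (A2b) there are $\Theta\in L(Q_h,V_h)$ which is onto and a constant $c_T\in\mathbb R$ with $\langle B^*p,\Theta p\rangle_{V',V}\ge\frac12\|p\|_Q^2-c_T\langle Tp,p\rangle_{Q_h',Q_h}$ for all $p\in Q_h$. Then $A_h$ is linearly mapped coercive.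
   Context: $L(\cdot,\cdot)$ denotes bounded linear operators. $X_h$ carries the norm $\|(u,p)\|_X^2=\|u\|_V^2+\|p\|_Q^2$. $B^*\in L(Q,V')$ is defined by $\langle B^*p,v\rangle_{V',V}=\langle Bv,p\rangle_{Q',Q}$. An operator $A:X\to Y'$ is called linearly mapped coercive if there is a bounded linear surjective map $\Phi\in L(X,Y)$ such that $\liminf_{\|x\|_X\to\infty}\frac{\langle A(x),\Phi x\rangle_{Y',Y}}{\|x\|_X}=+\infty$; here $X$ and $Y$ are both replaced by $X_h$. *)

theory Defs
  imports "HOL-Analysis.Analysis"
begin

text \<open>
  Closed subspaces are carrier sets \<open>X\<close>, \<open>Y\<close> inside ambient normed types, and operators on them are
  total functions of which only the values on the carriers matter.  A functional on \<open>Y\<close> is therefore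
  not unique as a HOL function: all notions below only look at its restriction to \<open>Y\<close>.
\<close>

definition linear_between ::
    "'a::real_vector set \<Rightarrow> 'b::real_vector set \<Rightarrow> ('a \<Rightarrow> 'b) \<Rightarrow> bool" where
  "linear_between X Y f \<longleftrightarrow>
     f ` X \<subseteq> Y \<and>
     (\<forall>x\<in>X. \<forall>x'\<in>X. f (x + x') = f x + f x') \<and>
     (\<forall>r. \<forall>x\<in>X. f (r *\<^sub>R x) = r *\<^sub>R f x)"

definition bounded_linear_ops ::
    "'a::real_normed_vector set \<Rightarrow> 'b::real_normed_vector set \<Rightarrow> ('a \<Rightarrow> 'b) set" where
  "bounded_linear_ops X Y =
     {f. linear_between X Y f \<and> (\<exists>K. \<forall>x\<in>X. norm (f x) \<le> K * norm x)}"

definition dual_on :: "'a::real_normed_vector set \<Rightarrow> ('a \<Rightarrow> real) set" where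
  "dual_on Y = bounded_linear_ops Y UNIV"

text \<open>The operator norm of a functional on \<open>Y\<close>: \<open>onorm\<close> with the supremum restricted to the carrier.\<close>

definition dual_norm_on :: "'a::real_normed_vector set \<Rightarrow> ('a \<Rightarrow> real) \<Rightarrow> real" where
  "dual_norm_on Y g = (SUP y\<in>Y. \<bar>g y\<bar> / norm y)"

text \<open>\<open>L(X, Y')\<close>; the linearity equations are equalities in \<open>Y'\<close>, i.e. pointwise on \<open>Y\<close>.\<close>

definition bounded_linear_to_dual ::
    "'a::real_normed_vector set \<Rightarrow> 'b::real_normed_vector set \<Rightarrow> ('a \<Rightarrow> 'b \<Rightarrow> real) set" where
  "bounded_linear_to_dual X Y =
     {A. (\<forall>x\<in>X. A x \<in> dual_on Y) \<and>
         (\<forall>x\<in>X. \<forall>x'\<in>X. \<forall>y\<in>Y. A (x + x') y = A x y + A x' y) \<and>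
         (\<forall>r. \<forall>x\<in>X. \<forall>y\<in>Y. A (r *\<^sub>R x) y = r * A x y) \<and>
         (\<exists>K. \<forall>x\<in>X. dual_norm_on Y (A x) \<le> K * norm x)}"

text \<open>\<open>B\<^sup>*\<close> for \<open>B \<in> L(V, Q')\<close>, restricted to \<open>Q \<subseteq> Q''\<close>.\<close>

definition dual_adjoint ::
    "('v::real_normed_vector \<Rightarrow>\<^sub>L 'q::real_normed_vector \<Rightarrow>\<^sub>L real) \<Rightarrow> 'q \<Rightarrow>\<^sub>L 'v \<Rightarrow>\<^sub>L real" where
  "dual_adjoint B = Blinfun (\<lambda>p. Blinfun (\<lambda>v. B v p))"

lemma dual_adjoint_apply [simp]: "dual_adjoint B p v = B v p"
proof -
  have bd: "\<bar>B v p\<bar> \<le> norm v * norm p * norm B" for v p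
  proof -
    have "\<bar>B v p\<bar> \<le> norm (B v) * norm p"
      using norm_blinfun[of "B v" p] by simp
    also have "\<dots> \<le> (norm B * norm v) * norm p"
      by (intro mult_right_mono norm_blinfun norm_ge_zero)
    finally show ?thesis by (simp add: mult_ac)
  qed
  have 1: "bounded_linear (\<lambda>v. B v p)" for p
    by (rule bounded_linear_intro[where K = "norm p * norm B"])
      (use bd[of _ p] in \<open>auto simp: blinfun.bilinear_simps mult.assoc\<close>)
  have 2: "bounded_linear (\<lambda>p. Blinfun (\<lambda>v. B v p))"
  proof (rule bounded_linear_intro[where K = "norm B"])
    fix x show "norm (Blinfun (\<lambda>v. B v x)) \<le> norm x * norm B"
      by (rule norm_blinfun_bound)
        (use bd[of _ x] in \<open>auto simp: bounded_linear_Blinfun_apply[OF 1] mult_ac\<close>)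
  qed (rule blinfun_eqI,
      simp only: plus_blinfun.rep_eq scaleR_blinfun.rep_eq bounded_linear_Blinfun_apply[OF 1],
      simp add: blinfun.bilinear_simps)+
  show ?thesis
    by (simp add: dual_adjoint_def bounded_linear_Blinfun_apply[OF 1] bounded_linear_Blinfun_apply[OF 2])
qed

text \<open>The limit inferior is taken over \<open>x \<in> X\<close> only, and in the extended reals.\<close>

definition linearly_mapped_coercive ::
    "'a::real_normed_vector set \<Rightarrow> 'b::real_normed_vector set \<Rightarrow> ('a \<Rightarrow> 'b \<Rightarrow> real) \<Rightarrow> bool" where
  "linearly_mapped_coercive X Y A \<longleftrightarrow>
     (\<forall>x\<in>X. A x \<in> dual_on Y) \<and>
     (\<exists>\<Phi>. \<Phi> \<in> bounded_linear_ops X Y \<and> \<Phi> ` X = Y \<and>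
        Liminf (inf at_infinity (principal X)) (\<lambda>x. ereal (A x (\<Phi> x) / norm x)) = \<infinity>)"

lemma dual_norm_on_leI:
  assumes "Y \<noteq> {}" "0 \<le> C" "\<And>y. y \<in> Y \<Longrightarrow> \<bar>g y\<bar> \<le> C * norm y"
  shows "dual_norm_on Y g \<le> C"
  unfolding dual_norm_on_def
proof (rule cSUP_least)
  fix y assume "y \<in> Y"
  then show "\<bar>g y\<bar> / norm y \<le> C"
    using assms(2,3) by (cases "y = 0") (simp_all add: pos_divide_le_eq)
qed (fact assms(1))

lemma dual_norm_on_bound:
  assumes "g \<in> dual_on Y" "y \<in> Y"
  shows "\<bar>g y\<bar> \<le> dual_norm_on Y g * norm y"
proof -
  obtain K where K: "\<And>y. y \<in> Y \<Longrightarrow> \<bar>g y\<bar> \<le> K * norm y"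
    using assms(1) by (auto simp: dual_on_def bounded_linear_ops_def)
  have "bdd_above ((\<lambda>y. \<bar>g y\<bar> / norm y) ` Y)"
  proof (rule bdd_aboveI2)
    fix y assume "y \<in> Y"
    then show "\<bar>g y\<bar> / norm y \<le> \<bar>K\<bar>"
      using K[of y] by (cases "y = 0")
        (auto simp: pos_divide_le_eq intro: order_trans mult_right_mono[OF abs_ge_self])
  qed
  then have *: "\<bar>g y\<bar> / norm y \<le> dual_norm_on Y g"
    unfolding dual_norm_on_def using assms(2) by (rule cSUP_upper[rotated])
  show ?thesis
    using * K[OF assms(2)] by (cases "y = 0") (auto simp: pos_divide_le_eq)
qed

text \<open>The saddle-point formula always defines an element of \<open>L(X\<^sub>h, X\<^sub>h')\<close>.\<close>

lemma saddle_point_operator_bounded: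
  fixes L :: "'v::real_inner \<Rightarrow>\<^sub>L 'v \<Rightarrow>\<^sub>L real" and B :: "'v \<Rightarrow>\<^sub>L 'q::real_inner \<Rightarrow>\<^sub>L real"
  assumes Vh: "subspace Vh" and Qh: "subspace Qh"
    and T: "T \<in> bounded_linear_to_dual Qh Qh"
    and A: "\<And>u p v q. \<lbrakk>u \<in> Vh; p \<in> Qh; v \<in> Vh; q \<in> Qh\<rbrakk> \<Longrightarrow>
               A (u, p) (v, q) = (L u - dual_adjoint B p) v + B u q + T p q"
  shows "A \<in> bounded_linear_to_dual (Vh \<times> Qh) (Vh \<times> Qh)"
proof -
  obtain K0 where K0: "\<And>p. p \<in> Qh \<Longrightarrow> dual_norm_on Qh (T p) \<le> K0 * norm p"
    using T unfolding bounded_linear_to_dual_def by blast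
  define K where "K = \<bar>K0\<bar>"
  have Tdual: "T p \<in> dual_on Qh" if "p \<in> Qh" for p
    using T that by (auto simp: bounded_linear_to_dual_def)
  have Tb: "\<bar>T p q\<bar> \<le> K * norm p * norm q" if "p \<in> Qh" "q \<in> Qh" for p q
  proof -
    have "\<bar>T p q\<bar> \<le> dual_norm_on Qh (T p) * norm q"
      using dual_norm_on_bound Tdual that by blast
    also have "\<dots> \<le> (K * norm p) * norm q"
      unfolding K_def
      by (intro mult_right_mono order_trans[OF K0[OF that(1)]] abs_ge_self norm_ge_zero)
    finally show ?thesis .
  qed
  have Tadd1: "T (p + p') q = T p q + T p' q" if "p \<in> Qh" "p' \<in> Qh" "q \<in> Qh" for p p' q
    using T that by (auto simp: bounded_linear_to_dual_def)
  have Tsc1: "T (r *\<^sub>R p) q = r * T p q" if "p \<in> Qh" "q \<in> Qh" for p q r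
    using T that by (auto simp: bounded_linear_to_dual_def)
  have Tadd2: "T p (q + q') = T p q + T p q'" if "p \<in> Qh" "q \<in> Qh" "q' \<in> Qh" for p q q'
    using Tdual[OF that(1)] that by (auto simp: dual_on_def bounded_linear_ops_def linear_between_def)
  have Tsc2: "T p (r *\<^sub>R q) = r * T p q" if "p \<in> Qh" "q \<in> Qh" for p q r
    using Tdual[OF that(1)] that by (auto simp: dual_on_def bounded_linear_ops_def linear_between_def)
  have bil: "\<bar>M x y\<bar> \<le> norm M * norm x * norm y"
    for M :: "'c::real_normed_vector \<Rightarrow>\<^sub>L 'd::real_normed_vector \<Rightarrow>\<^sub>L real" and x y
  proof -
    have "\<bar>M x y\<bar> \<le> norm (M x) * norm y" using norm_blinfun[of "M x" y] by simp
    also have "\<dots> \<le> (norm M * norm x) * norm y"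
      by (intro mult_right_mono norm_blinfun norm_ge_zero)
    finally show ?thesis .
  qed
  define C where "C = norm L + 2 * norm B + K"
  have C0: "0 \<le> C" by (simp add: C_def K_def)
  have Ab: "\<bar>A x y\<bar> \<le> C * norm x * norm y" if "x \<in> Vh \<times> Qh" "y \<in> Vh \<times> Qh" for x y
  proof -
    obtain u p v q where xy: "x = (u, p)" "y = (v, q)" by (cases x, cases y)
    have mem: "u \<in> Vh" "p \<in> Qh" "v \<in> Vh" "q \<in> Qh" using that xy by auto
    have n: "norm u \<le> norm x" "norm p \<le> norm x" "norm v \<le> norm y" "norm q \<le> norm y"
      by (simp_all add: xy norm_fst_le norm_snd_le)
    have K: "0 \<le> K" by (simp add: K_def)
    have "\<bar>L u v\<bar> \<le> norm L * norm x * norm y"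
      by (rule order_trans[OF bil]) (intro mult_mono n order_refl mult_nonneg_nonneg norm_ge_zero)
    moreover have "\<bar>B v p\<bar> \<le> norm B * norm y * norm x"
      by (rule order_trans[OF bil]) (intro mult_mono n order_refl mult_nonneg_nonneg norm_ge_zero)
    moreover have "\<bar>B u q\<bar> \<le> norm B * norm x * norm y"
      by (rule order_trans[OF bil]) (intro mult_mono n order_refl mult_nonneg_nonneg norm_ge_zero)
    moreover have "\<bar>T p q\<bar> \<le> K * norm x * norm y"
      by (rule order_trans[OF Tb[OF mem(2,4)]])
        (intro mult_mono n order_refl mult_nonneg_nonneg norm_ge_zero K)
    moreover have "A x y = L u v - B v p + B u q + T p q"
      by (simp add: xy A[OF mem] blinfun.bilinear_simps)
    ultimately show ?thesis
      by (simp add: C_def algebra_simps)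
  qed
  note cl = subspace_add[OF Vh] subspace_add[OF Qh] subspace_scale[OF Vh] subspace_scale[OF Qh]
  have dual: "A x \<in> dual_on (Vh \<times> Qh)" if "x \<in> Vh \<times> Qh" for x
  proof -
    have "linear_between (Vh \<times> Qh) UNIV (A x)"
      unfolding linear_between_def using that cl
      by (auto simp: A Tadd2 Tsc2 blinfun.bilinear_simps algebra_simps)
    moreover have "\<exists>K. \<forall>y\<in>Vh \<times> Qh. norm (A x y) \<le> K * norm y"
      using Ab[OF that] by (intro exI[of _ "C * norm x"]) simp
    ultimately show ?thesis by (simp add: dual_on_def bounded_linear_ops_def)
  qed
  have ne: "Vh \<times> Qh \<noteq> {}" using subspace_0[OF Vh] subspace_0[OF Qh] by blast
  have "dual_norm_on (Vh \<times> Qh) (A x) \<le> C * norm x" if "x \<in> Vh \<times> Qh" for x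
    by (rule dual_norm_on_leI[OF ne]) (use C0 Ab[OF that] in auto)
  then have "\<exists>K. \<forall>x\<in>Vh \<times> Qh. dual_norm_on (Vh \<times> Qh) (A x) \<le> K * norm x"
    by blast
  moreover have "\<forall>x\<in>Vh \<times> Qh. \<forall>x'\<in>Vh \<times> Qh. \<forall>y\<in>Vh \<times> Qh. A (x + x') y = A x y + A x' y"
    using cl by (auto simp: A Tadd1 blinfun.bilinear_simps algebra_simps)
  moreover have "\<forall>r. \<forall>x\<in>Vh \<times> Qh. \<forall>y\<in>Vh \<times> Qh. A (r *\<^sub>R x) y = r * A x y"
    using cl by (auto simp: A Tsc1 blinfun.bilinear_simps algebra_simps)
  ultimately show ?thesis
    using dual unfolding bounded_linear_to_dual_def by blast
qed

end

theory Submission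
  imports Defs
begin

text \<open>
  Test with \<open>\<Phi>(u, p) = (\<lambda>u - \<Theta>p, \<lambda>p)\<close> for large \<open>\<lambda>\<close>: the two terms \<open>\<mp>\<lambda>\<langle>Bu, p\<rangle>\<close> cancel, \<open>\<langle>B\<^sup>*p, \<Theta>p\<rangle>\<close>
  controls \<open>\<parallel>p\<parallel>\<^sup>2\<close> up to a multiple of \<open>\<langle>Tp, p\<rangle>\<close>, which \<open>\<lambda>\<langle>Tp, p\<rangle>\<close> absorbs, and the cross term
  \<open>\<langle>Lu, \<Theta>p\<rangle>\<close> is absorbed by Young's inequality.  The map \<open>\<Phi>\<close> is block triangular with the
  invertible diagonal entries \<open>\<lambda>\<close>, hence it is onto.
\<close>

text \<open>Dividing the quadratic lower bound by \<open>norm x\<close> leaves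
  \<open>c * norm x\<close>, which exceeds any given \<open>r\<close> as soon as
  \<open>norm x\<close> is at least \<open>r / c\<close>. This turns the limit inferior into a
  pointwise estimate on \<open>X\<close>.\<close>

lemma linearly_mapped_coerciveI:
  assumes "\<And>x. x \<in> X \<Longrightarrow> A x \<in> dual_on Y"
    and "\<Phi> \<in> bounded_linear_ops X Y" "\<Phi> ` X = Y"
    and c: "0 < c" and coercive: "\<And>x. x \<in> X \<Longrightarrow> c * (norm x)\<^sup>2 \<le> A x (\<Phi> x)"
  shows "linearly_mapped_coercive X Y A"
proof -
  let ?F = "inf at_infinity (principal X)"
  have "ereal r \<le> Liminf ?F (\<lambda>x. ereal (A x (\<Phi> x) / norm x))" for r
  proof (rule Liminf_bounded)
    \<comment> \<open>The bound \<open>1\<close> keeps \<open>norm x\<close> positive, which the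
      division needs, since \<open>r / c\<close> may be negative.\<close>
    have "\<forall>\<^sub>F x in at_infinity. max 1 (r / c) \<le> norm x"
      unfolding eventually_at_infinity by blast
    then show "\<forall>\<^sub>F x in ?F. ereal r \<le> ereal (A x (\<Phi> x) / norm x)"
      unfolding eventually_inf_principal
    proof eventually_elim
      case (elim x)
      show ?case
      proof
        assume "x \<in> X"
        have pos: "0 < norm x" using elim by linarith
        have "r / c \<le> norm x" using elim by simp
        then have "r \<le> c * norm x" using c by (simp add: pos_divide_le_eq mult.commute)
        then have "r * norm x \<le> c * norm x * norm x"
          by (rule mult_right_mono) simp
        also have "\<dots> \<le> A x (\<Phi> x)"
          using coercive[OF \<open>x \<in> X\<close>] by (simp add: power2_eq_square mult.assoc)
        finally show "ereal r \<le> ereal (A x (\<Phi> x) / norm x)"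
          using pos by (simp add: pos_le_divide_eq)
      qed
    qed
  qed
  then have "Liminf ?F (\<lambda>x. ereal (A x (\<Phi> x) / norm x)) = \<infinity>"
    by (rule ereal_top)
  with assms(1-3) show ?thesis
    unfolding linearly_mapped_coercive_def by blast
qed

lemma block_triangular_bounded_linear_ops:
  fixes Vh :: "'v::real_normed_vector set" and Qh :: "'q::real_normed_vector set"
  assumes Vh: "subspace Vh" and Qh: "subspace Qh" and \<Theta>: "\<Theta> \<in> bounded_linear_ops Qh Vh"
  shows "(\<lambda>(u, p). (l *\<^sub>R u - \<Theta> p, l *\<^sub>R p)) \<in> bounded_linear_ops (Vh \<times> Qh) (Vh \<times> Qh)"
proof -
  have \<Theta>_in: "\<Theta> p \<in> Vh" if "p \<in> Qh" for p
    using \<Theta> that by (auto simp: bounded_linear_ops_def linear_between_def)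
  have \<Theta>_add: "\<Theta> (p + q) = \<Theta> p + \<Theta> q" if "p \<in> Qh" "q \<in> Qh" for p q
    using \<Theta> that by (auto simp: bounded_linear_ops_def linear_between_def)
  have \<Theta>_scale: "\<Theta> (r *\<^sub>R p) = r *\<^sub>R \<Theta> p" if "p \<in> Qh" for r p
    using \<Theta> that by (auto simp: bounded_linear_ops_def linear_between_def)
  obtain K where K: "\<And>p. p \<in> Qh \<Longrightarrow> norm (\<Theta> p) \<le> K * norm p"
    using \<Theta> by (auto simp: bounded_linear_ops_def)
  have "norm (l *\<^sub>R u - \<Theta> p, l *\<^sub>R p) \<le> (2 * \<bar>l\<bar> + \<bar>K\<bar>) * norm (u, p)" if "p \<in> Qh" for u p
  proof -
    have "norm (l *\<^sub>R u - \<Theta> p, l *\<^sub>R p) \<le> norm (l *\<^sub>R u - \<Theta> p) + norm (l *\<^sub>R p)"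
      by (rule norm_Pair_le)
    also have "\<dots> \<le> \<bar>l\<bar> * norm u + K * norm p + \<bar>l\<bar> * norm p"
      using norm_triangle_ineq4[of "l *\<^sub>R u" "\<Theta> p"] K[OF that] by simp
    \<comment> \<open>The sign of \<open>K\<close> is unknown, so its absolute value is taken before
      \<open>norm p\<close> is enlarged to the norm of the pair.\<close>
    also have "\<dots> \<le> \<bar>l\<bar> * norm (u, p) + \<bar>K\<bar> * norm (u, p) + \<bar>l\<bar> * norm (u, p)"
      using norm_fst_le[of u p] norm_snd_le[of p u] by (intro add_mono mult_mono) auto
    finally show ?thesis by (simp add: algebra_simps)
  qed
  then have "\<exists>K. \<forall>x\<in>Vh \<times> Qh. norm (case x of (u, p) \<Rightarrow> (l *\<^sub>R u - \<Theta> p, l *\<^sub>R p)) \<le> K * norm x"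
    by (intro exI[of _ "2 * \<bar>l\<bar> + \<bar>K\<bar>"]) auto
  moreover have "linear_between (Vh \<times> Qh) (Vh \<times> Qh) (\<lambda>(u, p). (l *\<^sub>R u - \<Theta> p, l *\<^sub>R p))"
    unfolding linear_between_def using \<Theta>_in Vh Qh
    by (auto simp: \<Theta>_add \<Theta>_scale algebra_simps subspace_add subspace_diff subspace_scale)
  ultimately show ?thesis
    by (simp add: bounded_linear_ops_def)
qed

lemma block_triangular_image:
  fixes Vh :: "'v::real_vector set" and Qh :: "'q::real_vector set"
  assumes Vh: "subspace Vh" and Qh: "subspace Qh" and \<Theta>: "\<Theta> ` Qh \<subseteq> Vh" and l: "l \<noteq> 0"
  shows "(\<lambda>(u, p). (l *\<^sub>R u - \<Theta> p, l *\<^sub>R p)) ` (Vh \<times> Qh) = Vh \<times> Qh"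
proof (intro equalityI subsetI)
  fix y assume "y \<in> Vh \<times> Qh"
  then obtain v q where y: "y = (v, q)" and mem: "v \<in> Vh" "q \<in> Qh" by auto
  \<comment> \<open>Back substitution: the second component fixes \<open>p\<close>, and the first
    one, \<open>l *\<^sub>R u - \<Theta> p = v\<close>, is then solved for \<open>u\<close>.\<close>
  define p where "p = inverse l *\<^sub>R q"
  have p: "p \<in> Qh" by (simp add: p_def mem Qh subspace_scale)
  then have "inverse l *\<^sub>R (v + \<Theta> p) \<in> Vh"
    using \<Theta> by (intro subspace_scale[OF Vh] subspace_add[OF Vh] mem) auto
  with p show "y \<in> (\<lambda>(u, p). (l *\<^sub>R u - \<Theta> p, l *\<^sub>R p)) ` (Vh \<times> Qh)"
    by (intro image_eqI[where x = "(inverse l *\<^sub>R (v + \<Theta> p), p)"]) (use l in \<open>auto simp: y p_def\<close>)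
qed (use \<Theta> Vh Qh in \<open>auto simp: subspace_diff subspace_scale image_subset_iff\<close>)

theorem corollary3p4:
  fixes Vh :: "'v::{real_inner, complete_space} set"
    and Qh :: "'q::{real_inner, complete_space} set"
    and L :: "'v \<Rightarrow>\<^sub>L 'v \<Rightarrow>\<^sub>L real"
    and B :: "'v \<Rightarrow>\<^sub>L 'q \<Rightarrow>\<^sub>L real"
    and T :: "'q \<Rightarrow> 'q \<Rightarrow> real"
    and A\<^sub>h :: "'v \<times> 'q \<Rightarrow> 'v \<times> 'q \<Rightarrow> real"
  assumes "separable_space (euclidean :: 'v topology)"
    and "separable_space (euclidean :: 'q topology)"
    and "subspace Vh" and "closed Vh"
    and "subspace Qh" and "closed Qh"
    and "T \<in> bounded_linear_to_dual Qh Qh"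
    and "A\<^sub>h \<in> bounded_linear_to_dual (Vh \<times> Qh) (Vh \<times> Qh)"
    and "\<And>u p v q. \<lbrakk>u \<in> Vh; p \<in> Qh; v \<in> Vh; q \<in> Qh\<rbrakk> \<Longrightarrow>
           A\<^sub>h (u, p) (v, q) = (L u - dual_adjoint B p) v + B u q + T p q"
    and A1: "\<exists>\<alpha>>0. \<forall>u. L u u \<ge> \<alpha> * (norm u)\<^sup>2"
    and A2a: "\<forall>p\<in>Qh. T p p \<ge> 0"
    and A2b: "\<exists>\<Theta> \<in> bounded_linear_ops Qh Vh. \<Theta> ` Qh = Vh \<and>
           (\<exists>c\<^sub>T::real. \<forall>p\<in>Qh. dual_adjoint B p (\<Theta> p) \<ge> 1 / 2 * (norm p)\<^sup>2 - c\<^sub>T * T p p)"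
  shows "linearly_mapped_coercive (Vh \<times> Qh) (Vh \<times> Qh) A\<^sub>h"
proof -
  obtain \<alpha> where \<alpha>: "0 < \<alpha>" and L: "\<And>u. \<alpha> * (norm u)\<^sup>2 \<le> L u u"
    using A1 by blast
  obtain \<Theta> c\<^sub>T where \<Theta>: "\<Theta> \<in> bounded_linear_ops Qh Vh" and \<Theta>_onto: "\<Theta> ` Qh = Vh"
    and infsup: "\<And>p. p \<in> Qh \<Longrightarrow> 1 / 2 * (norm p)\<^sup>2 - c\<^sub>T * T p p \<le> B (\<Theta> p) p"
    using A2b by auto
  obtain K where K: "\<And>p. p \<in> Qh \<Longrightarrow> norm (\<Theta> p) \<le> K * norm p"
    using \<Theta> by (auto simp: bounded_linear_ops_def)
  \<comment> \<open>\<open>C\<close> is the constant of the cross term: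
    \<open>L u (\<Theta> p)\<close> is at most \<open>C * norm u * norm p\<close>.\<close>
  define C where "C = norm L * \<bar>K\<bar>"
  \<comment> \<open>The first summand gives \<open>l\<close> at least \<open>c\<^sub>T\<close>. The
    second makes \<open>l * \<alpha>\<close> at least \<open>C\<^sup>2 + 1\<close>: the part
    \<open>C\<^sup>2\<close> pays for the cross term, and the part \<open>1\<close> survives as the
    coefficient of \<open>(norm u)\<^sup>2\<close>.\<close>
  define l where "l = \<bar>c\<^sub>T\<bar> + (C\<^sup>2 + 1) / \<alpha>"
  have "0 < (C\<^sup>2 + 1) / \<alpha>"
    using \<alpha> by (intro divide_pos_pos add_nonneg_pos) auto
  then have l_ge: "c\<^sub>T \<le> l" and l_pos: "0 < l"
    unfolding l_def by linarith+
  have l_\<alpha>: "C\<^sup>2 + 1 \<le> l * \<alpha>"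
    using \<alpha> by (simp add: l_def field_simps)
  \<comment> \<open>For \<open>p\<close>, the factor 1/2 from the lower bound on
    \<open>B (\<Theta> p) p\<close> loses 1/4 to the cross term; for \<open>u\<close>, the remaining
    factor 1 is more than enough.\<close>
  have coercive: "1 / 4 * (norm (u, p))\<^sup>2 \<le> A\<^sub>h (u, p) (l *\<^sub>R u - \<Theta> p, l *\<^sub>R p)"
    if u: "u \<in> Vh" and p: "p \<in> Qh" for u p
  proof -
    have Tp: "T p \<in> dual_on Qh"
      using assms(7) p by (auto simp: bounded_linear_to_dual_def)
    have T_scale: "T p (l *\<^sub>R p) = l * T p p"
      using Tp p by (auto simp: dual_on_def bounded_linear_ops_def linear_between_def)
    have mem: "l *\<^sub>R u - \<Theta> p \<in> Vh" "l *\<^sub>R p \<in> Qh"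
      using u p \<Theta>_onto assms(3,5) by (auto simp: subspace_diff subspace_scale)
    have "A\<^sub>h (u, p) (l *\<^sub>R u - \<Theta> p, l *\<^sub>R p) = l * L u u - L u (\<Theta> p) + B (\<Theta> p) p + l * T p p"
      by (simp add: assms(9)[OF u p mem] T_scale blinfun.bilinear_simps algebra_simps)
    moreover have "L u (\<Theta> p) \<le> C\<^sup>2 * (norm u)\<^sup>2 + 1 / 4 * (norm p)\<^sup>2"
    proof -
      have "L u (\<Theta> p) \<le> norm (L u) * norm (\<Theta> p)"
        using norm_blinfun[of "L u" "\<Theta> p"] by simp
      also have "\<dots> \<le> (norm L * norm u) * (\<bar>K\<bar> * norm p)"
        by (intro mult_mono norm_blinfun order_trans[OF K[OF p]]) (auto intro: mult_right_mono)
      \<comment> \<open>The weights in Young's inequality are chosen so that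
        \<open>(norm p)\<^sup>2\<close> is charged only 1/4.\<close>
      also have "\<dots> = 2 * (C * norm u) * (1 / 2 * norm p)"
        by (simp add: C_def)
      also have "\<dots> \<le> (C * norm u)\<^sup>2 + (1 / 2 * norm p)\<^sup>2"
        by (rule sum_squares_bound)
      finally show ?thesis by (simp add: power_mult_distrib power_divide)
    qed
    moreover have "(C\<^sup>2 + 1) * (norm u)\<^sup>2 \<le> l * L u u"
    proof -
      have "(C\<^sup>2 + 1) * (norm u)\<^sup>2 \<le> (l * \<alpha>) * (norm u)\<^sup>2"
        by (rule mult_right_mono[OF l_\<alpha>]) simp
      also have "\<dots> \<le> l * L u u"
        using L[of u] l_pos by (simp add: mult.assoc)
      finally show ?thesis .
    qed
    \<comment> \<open>Nonnegativity of \<open>T p p\<close> lets \<open>c\<^sub>T\<close> be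
      replaced by the larger \<open>l\<close>, whatever the sign of
      \<open>c\<^sub>T\<close>.\<close>
    moreover have "c\<^sub>T * T p p \<le> l * T p p"
      using A2a p by (intro mult_right_mono l_ge) auto
    moreover have "(norm (u, p))\<^sup>2 = (norm u)\<^sup>2 + (norm p)\<^sup>2"
      by (simp add: norm_prod_def)
    moreover have "0 \<le> (norm u)\<^sup>2" by simp
    \<comment> \<open>Once \<open>(C\<^sup>2 + 1) * (norm u)\<^sup>2\<close> is expanded, its
      product \<open>C\<^sup>2 * (norm u)\<^sup>2\<close> cancels the one from Young's inequality,
      and the rest is linear.\<close>
    ultimately show ?thesis
      using infsup[OF p] unfolding distrib_right by linarith
  qed
  show ?thesis
  proof (rule linearly_mapped_coerciveI)
    show "(\<lambda>(u, p). (l *\<^sub>R u - \<Theta> p, l *\<^sub>R p)) \<in> bounded_linear_ops (Vh \<times> Qh) (Vh \<times> Qh)"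
      by (rule block_triangular_bounded_linear_ops[OF assms(3,5) \<Theta>])
    show "(\<lambda>(u, p). (l *\<^sub>R u - \<Theta> p, l *\<^sub>R p)) ` (Vh \<times> Qh) = Vh \<times> Qh"
      using block_triangular_image[OF assms(3,5)] \<Theta>_onto l_pos by simp
    show "A\<^sub>h x \<in> dual_on (Vh \<times> Qh)" if "x \<in> Vh \<times> Qh" for x
      using assms(8) that by (auto simp: bounded_linear_to_dual_def)
    show "1 / 4 * (norm x)\<^sup>2 \<le> A\<^sub>h x ((\<lambda>(u, p). (l *\<^sub>R u - \<Theta> p, l *\<^sub>R p)) x)"
      if "x \<in> Vh \<times> Qh" for x
      using that coercive by auto
  qed simp
qed

end
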